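(* Let $p>1$ be a prime and let $h$ have odd order $k\geq3$ in the multiplicative group $(\mathbb Z/p\mathbb Z)^*$. Then $$|s(h,p)|\ll (\log p)^2p^{1-\frac{1}{\phi(k)}},$$ with an absolute implied constant.
   Context: For integers $c,d$ with $d\geq1$ and $\gcd(c,d)=1$, the Dedekind sum is $s(c,d)=\frac{1}{4d}\sum_{n=1}^{d-1}\cot\left(\frac{\pi n}{d}\right)\cot\left(\frac{\pi nc}{d}\right)$, equivalently $s(c,d)=\sum_{a=1}^{d-1}((a/d))((ac/d))$ with $((x))=x-\lfloor x\rfloor-1/2$ for $x\notin\mathbb Z$ and $((x))=0$ for $x\in\mathbb Z$. It depends only on $c$ modulo $d$. *)

theory Defs
  imports "HOL-Analysis.Analysis" "HOL-Number_Theory.Number_Theory"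
begin

text \<open>
  Meaningful for \<open>d \<ge> 1\<close> and \<open>c\<close> coprime to \<open>d\<close>: then none of the cotangents is taken
  at a multiple of \<open>\<pi>\<close>.
\<close>

definition dedekind_sum :: "int \<Rightarrow> nat \<Rightarrow> real" where
  "dedekind_sum c d =
     1 / (4 * real d) *
       (\<Sum>n = 1..<d. cot (pi * real n / real d) * cot (pi * real n * real_of_int c / real d))"

lemma dedekind_sum_mod: "dedekind_sum (c mod int d) d = dedekind_sum c d"
proof (cases "d = 0")
  case False
  have "cot (pi * real n * real_of_int (c mod int d) / real d) =
        cot (pi * real n * real_of_int c / real d)" for n
  proof -
    have c: "real_of_int c = real_of_int (c mod int d) + real d * real_of_int (c div int d)"
      by (metis add.commute mult_div_mod_eq of_int_add of_int_mult of_int_of_nat_eq)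
    define m where "m = int n * (c div int d)"
    have eq: "pi * real n * real_of_int c / real d =
        pi * real n * real_of_int (c mod int d) / real d + real_of_int m * pi"
      unfolding m_def using False by (subst c) (simp add: field_simps)
    have per: "cot (x + real_of_int m * pi) = cot x" for x :: real
      using sin_npi_int[of m] cos_npi_int[of m]
      by (cases "even m") (simp_all add: cot_def sin_add cos_add mult.commute)
    show ?thesis unfolding eq per ..
  qed
  then show ?thesis by (simp add: dedekind_sum_def)
qed (simp add: dedekind_sum_def)

text \<open>
  The group \<open>(\<int>/n\<int>)\<^sup>*\<close>, carried by the reduced representatives in \<open>{0..n - 1}\<close>.
\<close>

abbreviation residue_units :: "nat \<Rightarrow> int monoid" where
  "residue_units n \<equiv> units_of (residue_ring (int n))"

end

theory Submission
  imports Defs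
begin

text \<open>
  Let \<open>L = p powr (1/\<phi>(k)) / 2\<close>. The \<open>k\<close>-th cyclotomic polynomial vanishes at \<open>h\<close> modulo \<open>p\<close>, so its
  homogenisation takes a value divisible by \<open>p\<close> at every lattice point \<open>(a, b)\<close> with
  \<open>b \<equiv> h a\<close> modulo \<open>p\<close>. As \<open>k \<ge> 3\<close> that value is nonzero unless \<open>a = b = 0\<close>, and it is at most
  \<open>(|a| + |b|)\<close> to the power \<open>\<phi>(k)\<close>; hence \<open>|a| + |b| \<ge> 2L\<close> for all points with \<open>p\<close> not dividing \<open>a\<close>.
  Since \<open>|x cot x| \<le> 1\<close> for \<open>|x| \<le> \<pi>/2\<close>, the Dedekind sum is at most \<open>p\<close> times the sum of
  \<open>1/|ab|\<close> over the lattice points with \<open>0 < |a|, |b| \<le> p/2\<close>. These points are pairwise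
  separated by \<open>2L\<close>, so counting them in squares of side \<open>L\<close> bounds that sum by
  \<open>O((log p)\<^sup>2 / L)\<close>.
\<close>

hide_const (open) up_ring.coeff up_ring.monom

subsection \<open>Cyclotomic polynomials\<close>

text \<open>A predicate on complex polynomials, because cyclotomic polynomials are built below from
  their complex roots.\<close>

definition int_coeffs :: "complex poly \<Rightarrow> bool" where
  "int_coeffs p \<longleftrightarrow> (\<forall>i. coeff p i \<in> \<int>)"

lemma int_coeffs_1: "int_coeffs 1"
  by (auto simp: int_coeffs_def)

lemma int_coeffs_mult: "int_coeffs p \<Longrightarrow> int_coeffs q \<Longrightarrow> int_coeffs (p * q)"
  unfolding int_coeffs_def coeff_mult by (intro allI Ints_sum Ints_mult) auto

lemma int_coeffs_prod: "(\<And>x. x \<in> A \<Longrightarrow> int_coeffs (f x)) \<Longrightarrow> int_coeffs (prod f A)"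
  by (induction A rule: infinite_finite_induct) (auto simp: int_coeffs_1 int_coeffs_mult)

lemma int_coeffs_poly:
  assumes "int_coeffs p" "x \<in> \<int>"
  shows "poly p x \<in> \<int>"
  using assms unfolding poly_altdef int_coeffs_def
  by (intro Ints_sum Ints_mult Ints_power) auto

text \<open>Division by a monic polynomial creates no denominators: \<open>q\<close> has the leading
  coefficient of \<open>g * q\<close>, and removing its leading monomial lowers the degree.\<close>

lemma int_coeffs_cofactor:
  assumes "int_coeffs g" "lead_coeff g = 1" "int_coeffs (g * q)"
  shows "int_coeffs q"
  using assms(3)
proof (induction "degree q" arbitrary: q rule: less_induct)
  case less
  show ?case
  \<comment> \<open>Constants are the base case: removing their leading monomial leaves degree 0,
    which is no descent.\<close>
  proof (cases "degree q = 0")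
    case True
    then obtain c where q: "q = [:c:]" by (rule degree_eq_zeroE)
    have "coeff (g * q) (degree g) \<in> \<int>" using less.prems by (auto simp: int_coeffs_def)
    then have "c \<in> \<int>" using assms(2) by (simp add: q)
    then show ?thesis by (auto simp: q int_coeffs_def coeff_pCons split: nat.splits)
  next
    case False
    define m where "m = monom (lead_coeff q) (degree q)"
    have "lead_coeff (g * q) = lead_coeff q" using assms(2) by (simp add: lead_coeff_mult)
    moreover have "lead_coeff (g * q) \<in> \<int>" using less.prems by (auto simp: int_coeffs_def)
    ultimately have m: "int_coeffs m" by (simp add: int_coeffs_def m_def)
    have lt: "degree (q - m) < degree q"
    proof (cases "q - m = 0")
      case True
      then show ?thesis using False by simp
    next
      case neq: False
      have "degree (q - m) \<le> degree q"
        unfolding m_def by (intro degree_diff_le) (auto intro: degree_monom_le)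
      moreover have "coeff (q - m) (degree q) = 0" by (simp add: m_def)
      ultimately show ?thesis using neq by (metis leading_coeff_0_iff le_neq_implies_less)
    qed
    have "int_coeffs (g * (q - m))"
      using less.prems int_coeffs_mult[OF assms(1) m]
      by (auto simp: int_coeffs_def algebra_simps)
    from less.hyps[OF lt this] m have "int_coeffs (q - m + m)"
      unfolding int_coeffs_def by (metis Ints_add coeff_add)
    then show ?thesis by simp
  qed
qed

section \<open>Primitive roots of unity and cyclotomic polynomials\<close>

definition prim_roots :: "nat \<Rightarrow> complex set" where
  "prim_roots n = {z. \<forall>m. z ^ m = 1 \<longleftrightarrow> n dvd m}"

lemma prim_rootsD: "z \<in> prim_roots n \<Longrightarrow> z ^ m = 1 \<longleftrightarrow> n dvd m"
  by (simp add: prim_roots_def)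

lemma prim_roots_disjoint: "m \<noteq> n \<Longrightarrow> prim_roots m \<inter> prim_roots n = {}"
  unfolding prim_roots_def by (metis (mono_tags, lifting) disjoint_iff dvd_antisym dvd_refl mem_Collect_eq)

lemma finite_prim_roots: 
  assumes "n > 0" 
  shows "finite (prim_roots n)"
proof (rule finite_subset)
  show "prim_roots n \<subseteq> {z. z ^ n = 1}" by (simp add: subset_iff prim_rootsD)
  show "finite {z::complex. z ^ n = 1}" using assms by (intro finite_roots_unity) simp
qed

lemma roots_unity_eq_Union:
  assumes "n > 0"
  shows "{z. z ^ n = 1} = (\<Union>d\<in>{d. d dvd n}. prim_roots d)"
proof (intro equalityI subsetI)
  fix z :: complex
  assume "z \<in> {z. z ^ n = 1}"
  then have z: "z ^ n = 1" by simp
  \<comment> \<open>\<open>d\<close> is the exact order of \<open>z\<close>: by division with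
    remainder and minimality it divides every exponent \<open>m\<close> with
    \<open>z ^ m = 1\<close>.\<close>
  define d where "d = (LEAST d. d > 0 \<and> z ^ d = 1)"
  have d: "d > 0" "z ^ d = 1"
    using LeastI[of "\<lambda>d. d > 0 \<and> z ^ d = 1" n] z assms by (auto simp: d_def)
  have iff: "z ^ m = 1 \<longleftrightarrow> d dvd m" for m
  proof
    assume m: "z ^ m = 1"
    have "z ^ m = (z ^ d) ^ (m div d) * z ^ (m mod d)"
      by (simp flip: power_mult power_add)
    then have "z ^ (m mod d) = 1" using d m by simp
    moreover have "m mod d < d" using d by simp
    ultimately have "m mod d = 0"
      using not_less_Least[of "m mod d" "\<lambda>d. d > 0 \<and> z ^ d = 1"] by (auto simp: d_def)
    then show "d dvd m" by auto
  qed (auto simp: power_mult d elim!: dvdE)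
  then show "z \<in> (\<Union>d\<in>{d. d dvd n}. prim_roots d)"
    using z iff by (intro UN_I[of d]) (simp_all add: prim_roots_def)
qed (auto simp: prim_rootsD)

text \<open>Both counts sum to \<open>n\<close> over the divisors of \<open>n\<close>: the
  \<open>n\<close>-th roots of unity split by exact order, and the totient satisfies Gauss's
  identity. Strong induction cancels the proper divisors.\<close>

lemma card_prim_roots:
  assumes "n > 0"
  shows "card (prim_roots n) = totient n"
  using assms
proof (induction n rule: less_induct)
  case (less n)
  let ?D = "{d. d dvd n}"
  have fin: "finite ?D" using less.prems by simp
  have "(\<Sum>d\<in>?D. card (prim_roots d)) = card (\<Union>d\<in>?D. prim_roots d)"
    using fin less.prems prim_roots_disjoint
    by (intro card_UN_disjoint [symmetric] ballI impI finite_prim_roots) (auto intro: dvd_pos_nat)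
  also have "\<dots> = n"
    using card_roots_unity_eq[of n] less.prems by (simp flip: roots_unity_eq_Union)
  also have "\<dots> = (\<Sum>d\<in>?D. totient d)" by (simp add: totient_divisor_sum)
  finally have *: "(\<Sum>d\<in>?D. card (prim_roots d)) = (\<Sum>d\<in>?D. totient d)" .
  have "(\<Sum>d\<in>?D - {n}. card (prim_roots d)) = (\<Sum>d\<in>?D - {n}. totient d)"
    using less by (intro sum.cong less.IH) (auto intro: dvd_pos_nat simp: dvd_imp_le le_neq_implies_less)
  then show ?case using * sum.remove[OF fin, of n "\<lambda>d. card (prim_roots d)"]
      sum.remove[OF fin, of n totient] by simp
qed

text \<open>The product over the roots supplies the linear factors needed to estimate values;
  integrality of the coefficients is recovered separately.\<close>

definition cyclotomic :: "nat \<Rightarrow> complex poly" where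
  "cyclotomic n = (\<Prod>z\<in>prim_roots n. [:-z, 1:])"

lemma lead_coeff_cyclotomic: "lead_coeff (cyclotomic n) = 1"
  unfolding cyclotomic_def by (simp add: lead_coeff_prod)

lemma degree_cyclotomic: "n > 0 \<Longrightarrow> degree (cyclotomic n) = totient n"
  unfolding cyclotomic_def by (subst degree_prod_eq_sum_degree) (auto simp: card_prim_roots)

lemma prod_cyclotomic:
  assumes "n > 0"
  shows "(\<Prod>d | d dvd n. cyclotomic d) = monom 1 n - 1"
proof -
  let ?R = "{z::complex. z ^ n = 1}"
  have fin: "finite ?R" using finite_roots_unity[of n] assms by simp
  have cR: "card ?R = n" using card_roots_unity_eq assms by simp
  have "(\<Prod>d | d dvd n. cyclotomic d) = (\<Prod>z\<in>(\<Union>d\<in>{d. d dvd n}. prim_roots d). [:-z, 1:])"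
    unfolding cyclotomic_def using assms prim_roots_disjoint
    by (intro prod.UNION_disjoint [symmetric] ballI impI finite_prim_roots) (auto intro: dvd_pos_nat)
  also have "\<dots> = (\<Prod>z\<in>?R. [:-z, 1:])"
    using assms by (simp add: roots_unity_eq_Union)
  also have "\<dots> = monom 1 n - 1"
  \<comment> \<open>Polynomials of degree at most \<open>n\<close> that share the coefficient at
    \<open>n\<close> and the values at \<open>n\<close> points coincide; here both vanish at all
    \<open>n\<close>-th roots of unity.\<close>
  proof (rule poly_eqI_degree_lead_coeff[where A = ?R and n = n])
    have deg: "degree (\<Prod>z\<in>?R. [:-z, 1:]) = n"
      by (subst degree_prod_eq_sum_degree) (auto simp: cR)
    then show "degree (\<Prod>z\<in>?R. [:-z, 1:]) \<le> n" by simp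
    have "lead_coeff (\<Prod>z\<in>?R. [:-z, 1:]) = 1" by (simp add: lead_coeff_prod)
    then show "coeff (\<Prod>z\<in>?R. [:-z, 1:]) n = coeff (monom 1 n - 1) n"
      using assms deg by simp
    show "degree (monom 1 n - 1 :: complex poly) \<le> n"
      by (intro degree_diff_le) (auto simp: degree_monom_le)
    fix z assume z: "z \<in> ?R"
    then show "poly (\<Prod>z\<in>?R. [:-z, 1:]) z = poly (monom 1 n - 1) z"
      using fin by (simp add: poly_prod poly_monom prod_zero_iff)
  qed (simp add: cR)
  finally show ?thesis .
qed

text \<open>By induction the product over the proper divisors is integral, and it is monic;
  \<open>cyclotomic n\<close> is its cofactor in \<open>monom 1 n - 1\<close>.\<close>

lemma int_coeffs_cyclotomic:
  assumes "n > 0"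
  shows "int_coeffs (cyclotomic n)"
  using assms
proof (induction n rule: less_induct)
  case (less n)
  let ?D = "{d. d dvd n}"
  let ?g = "\<Prod>d\<in>?D - {n}. cyclotomic d"
  have fin: "finite ?D" using less.prems by simp
  have "?g * cyclotomic n = (\<Prod>d\<in>?D. cyclotomic d)"
    using fin by (subst prod.remove[of ?D n]) (auto simp: mult.commute)
  then have eq: "?g * cyclotomic n = monom 1 n - 1"
    using less.prems by (simp add: prod_cyclotomic)
  show ?case
  proof (rule int_coeffs_cofactor)
    show "int_coeffs ?g"
      using less
      by (intro int_coeffs_prod less.IH) (auto intro: dvd_pos_nat simp: dvd_imp_le le_neq_implies_less)
    show "lead_coeff ?g = 1" by (simp add: lead_coeff_prod lead_coeff_cyclotomic)
    show "int_coeffs (?g * cyclotomic n)" unfolding eq by (auto simp: int_coeffs_def)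
  qed
qed

section \<open>Cyclotomic values modulo a prime and lattice points\<close>

text \<open>\<open>p\<close> divides \<open>h ^ k - 1\<close>, the product of the cyclotomic values
  at \<open>h\<close> over the divisors of \<open>k\<close>, hence one factor \<open>N d\<close>. As
  \<open>N d\<close> divides \<open>h ^ d - 1\<close>, the order hypothesis forces
  \<open>d = k\<close>.\<close>

lemma prime_dvd_cyclotomic:
  fixes h :: int
  assumes p: "prime p" and k: "k > 0" and ord: "\<And>m. [h ^ m = 1] (mod int p) \<longleftrightarrow> k dvd m"
  obtains N where "poly (cyclotomic k) (of_int h) = of_int N" "int p dvd N"
proof -
  have "\<exists>N. \<forall>d. d dvd k \<longrightarrow> poly (cyclotomic d) (of_int h) = complex_of_int (N d)"
  proof (rule choice, rule allI)
    fix d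
    show "\<exists>y. d dvd k \<longrightarrow> poly (cyclotomic d) (of_int h) = complex_of_int y"
      using int_coeffs_poly[OF int_coeffs_cyclotomic[of d], of "of_int h"] k dvd_pos_nat[of k d]
      unfolding Ints_def by auto
  qed
  then obtain N where N: "\<And>d. d dvd k \<Longrightarrow> poly (cyclotomic d) (of_int h) = complex_of_int (N d)"
    by blast
  have prod: "(\<Prod>e | e dvd d. N e) = h ^ d - 1" if "d dvd k" for d
  proof -
    have "d > 0" using that k by (auto intro: dvd_pos_nat)
    have "complex_of_int (\<Prod>e | e dvd d. N e) = (\<Prod>e | e dvd d. poly (cyclotomic e) (of_int h))"
      unfolding of_int_prod using that by (intro prod.cong N[symmetric]) auto
    also have "\<dots> = of_int (h ^ d - 1)"
      using prod_cyclotomic[OF \<open>d > 0\<close>] by (simp flip: poly_prod add: poly_monom)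
    finally show ?thesis by (simp only: of_int_eq_iff)
  qed
  have "int p dvd h ^ k - 1" using ord[of k] by (simp add: cong_iff_dvd_diff)
  then have "int p dvd (\<Prod>e | e dvd k. N e)" by (simp add: prod)
  moreover have "finite {e. e dvd k}" using k by simp
  ultimately obtain d where d: "d dvd k" "int p dvd N d"
    using p by (subst (asm) prime_dvd_prod_iff) auto
  have "finite {e. e dvd d}" using d k by (auto intro: dvd_pos_nat)
  then have "N d dvd (\<Prod>e | e dvd d. N e)" by (intro dvd_prodI) auto
  also have "\<dots> = h ^ d - 1" using d by (simp add: prod)
  finally have "int p dvd h ^ d - 1" using d dvd_trans by blast
  then have "d = k" using ord[of d] d by (auto simp: cong_iff_dvd_diff intro: dvd_antisym)
  then show ?thesis using that[of "N k"] N d by simp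
qed

text \<open>A real root of unity is 1 or -1, so its order divides 2.\<close>

lemma prim_roots_not_real:
  assumes "z \<in> prim_roots k" "k \<ge> 3"
  shows "z \<notin> \<real>"
proof
  assume "z \<in> \<real>"
  then obtain x where x: "z = of_real x" by (auto elim: Reals_cases)
  have "z ^ k = 1" using assms by (simp add: prim_rootsD)
  then have "\<bar>x\<bar> = 1" using power_eq_1_iff[of z k] assms x by auto
  then have "z ^ 2 = 1" by (auto simp: x power2_eq_square abs_if split: if_splits)
  then have "k dvd 2" using prim_rootsD[OF assms(1)] by blast
  then show False using assms by (auto dest!: dvd_imp_le)
qed

lemma lattice_point_lower_bound:
  fixes h a b :: int
  assumes p: "prime p" and k: "k \<ge> 3" and ord: "\<And>m. [h ^ m = 1] (mod int p) \<longleftrightarrow> k dvd m"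
    and a: "\<not> int p dvd a" and b: "[b = h * a] (mod int p)"
  shows "int p \<le> (\<bar>a\<bar> + \<bar>b\<bar>) ^ totient k"
proof -
  define t where "t = totient k"
  have k0: "k > 0" using k by simp
  have deg: "degree (cyclotomic k) = t" by (simp add: t_def degree_cyclotomic k0)
  obtain N where N: "poly (cyclotomic k) (of_int h) = of_int N" "int p dvd N"
    using prime_dvd_cyclotomic[OF p k0 ord] by blast
  have "\<exists>c. \<forall>i. coeff (cyclotomic k) i = complex_of_int (c i)"
    using int_coeffs_cyclotomic[OF k0] unfolding int_coeffs_def
    by (intro choice) (auto elim!: Ints_cases)
  then obtain c where c: "\<And>i. coeff (cyclotomic k) i = complex_of_int (c i)" by blast
  \<comment> \<open>The homogenised cyclotomic polynomial at \<open>(a, b)\<close>, an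
    integer.\<close>
  define F where "F = (\<Sum>i\<le>t. c i * b ^ i * a ^ (t - i))"
  have N': "N = (\<Sum>i\<le>t. c i * h ^ i)"
  proof -
    have "complex_of_int N = of_int (\<Sum>i\<le>t. c i * h ^ i)"
      unfolding N(1)[symmetric] by (simp add: poly_altdef deg c)
    then show ?thesis by (simp only: of_int_eq_iff)
  qed
  \<comment> \<open>Replacing \<open>b\<close> by \<open>h * a\<close> pulls out
    \<open>a ^ t\<close> and leaves the value \<open>N\<close> at \<open>h\<close>, a multiple of
    \<open>p\<close>.\<close>
  have "[F = (\<Sum>i\<le>t. c i * (h * a) ^ i * a ^ (t - i))] (mod int p)"
    unfolding F_def by (intro cong_sum cong_mult cong_pow b cong_refl)
  also have "(\<Sum>i\<le>t. c i * (h * a) ^ i * a ^ (t - i)) = N * a ^ t"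
    unfolding N' sum_distrib_right
    by (intro sum.cong) (auto simp: power_mult_distrib simp flip: power_add)
  finally have dvd: "int p dvd F" using N(2) by (auto simp: cong_dvd_iff)
  have a0: "a \<noteq> 0" using a by auto
  have F: "complex_of_int F = (\<Prod>z\<in>prim_roots k. of_int b - z * of_int a)"
  proof -
    have "complex_of_int F = of_int a ^ t * poly (cyclotomic k) (of_int b / of_int a)"
      unfolding F_def poly_altdef deg c sum_distrib_left of_int_sum
      using a0 by (intro sum.cong) (auto simp: power_divide field_simps simp flip: power_add)
    also have "\<dots> = (\<Prod>z\<in>prim_roots k. of_int a * (of_int b / of_int a - z))"
      by (simp add: cyclotomic_def poly_prod prod.distrib t_def card_prim_roots k0)
    also have "\<dots> = (\<Prod>z\<in>prim_roots k. of_int b - z * of_int a)"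
      using a0 by (intro prod.cong) (auto simp: field_simps)
    finally show ?thesis .
  qed
  \<comment> \<open>A vanishing linear factor would make a primitive root equal to the real number
    b/a.\<close>
  have "F \<noteq> 0"
  proof
    assume "F = 0"
    then obtain z where z: "z \<in> prim_roots k" "of_int b - z * of_int a = 0"
      using F finite_prim_roots[OF k0] by auto
    then have "z = of_real (of_int b / of_int a)" using a0 by (simp add: field_simps)
    then show False using prim_roots_not_real[OF z(1) k] by simp
  qed
  then have "int p \<le> \<bar>F\<bar>" using dvd by (metis dvd_imp_le_int abs_of_nat)
  also have "real_of_int \<bar>F\<bar> \<le> of_int ((\<bar>a\<bar> + \<bar>b\<bar>) ^ t)"
  proof -
    have "real_of_int \<bar>F\<bar> = norm (complex_of_int F)" by simp
    also have "\<dots> = (\<Prod>z\<in>prim_roots k. norm (of_int b - z * of_int a))"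
      unfolding F by (simp add: prod_norm)
    \<comment> \<open>Triangle inequality in each factor, with \<open>z\<close> on the unit
      circle.\<close>
    also have "\<dots> \<le> (\<Prod>z\<in>prim_roots k. real_of_int (\<bar>a\<bar> + \<bar>b\<bar>))"
    proof (intro prod_mono conjI)
      fix z assume z: "z \<in> prim_roots k"
      then have "z ^ k = 1" by (simp add: prim_rootsD)
      then have "norm z = 1" using power_eq_1_iff k0 by blast
      then show "norm (of_int b - z * of_int a) \<le> real_of_int (\<bar>a\<bar> + \<bar>b\<bar>)"
        using norm_triangle_ineq4[of "of_int b" "z * of_int a"] by (simp add: norm_mult)
    qed auto
    also have "\<dots> = of_int ((\<bar>a\<bar> + \<bar>b\<bar>) ^ t)"
      by (simp add: card_prim_roots k0 t_def)
    finally show ?thesis .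
  qed
  then have "\<bar>F\<bar> \<le> (\<bar>a\<bar> + \<bar>b\<bar>) ^ t" by (simp only: of_int_le_iff)
  finally show ?thesis by (simp add: t_def)
qed

text \<open>Turns the abstract group order into congruences between powers, the form in which the
  order is used elsewhere.\<close>

lemma residue_units_ord_dvd_iff:
  assumes "p > 1" "h mod int p \<in> carrier (residue_units p)"
  shows "group.ord (residue_units p) (h mod int p) dvd m \<longleftrightarrow> [h ^ m = 1] (mod int p)"
proof -
  interpret residues "int p" "residue_ring (int p)"
    by unfold_locales (use assms in auto)
  interpret U: group "residue_units p" by (rule units_group)
  have U: "h mod int p \<in> Units (residue_ring (int p))"
    using assms(2) by (simp add: units_of_carrier)
  show ?thesis
    unfolding U.pow_eq_id[OF assms(2), symmetric]
    using U assms(1)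
    by (simp add: units_of_pow units_of_one pow_cong res_one_eq cong_def)
qed

subsection \<open>Cotangents and separated points\<close>

lemma abs_mult_cot_le_1:
  fixes x :: real
  assumes "\<bar>x\<bar> \<le> pi / 2"
  shows "\<bar>x * cot x\<bar> \<le> 1"
proof -
  have *: "\<bar>y * cot y\<bar> \<le> 1" if y: "0 < y" "y \<le> pi / 2" for y :: real
  proof -
    \<comment> \<open>Mean value theorem for sin y - y cos y, whose derivative y sin y is
      nonnegative on this range.\<close>
    have "\<exists>z>0. z < y \<and> (sin y - y * cos y) - (sin 0 - 0 * cos 0) = (y - 0) * (z * sin z)"
      using y by (intro MVT2) (auto intro!: derivative_eq_intros)
    then obtain z where z: "0 < z" "z < y" "sin y - y * cos y = y * (z * sin z)" by auto
    have "0 \<le> sin z" using z y by (intro sin_ge_zero) auto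
    then have le: "y * cos y \<le> sin y" using z y by (simp add: algebra_simps)
    have "0 < sin y" using y pi_gt_zero by (intro sin_gt_zero) linarith+
    moreover have "0 \<le> cos y" using y by (intro cos_ge_zero) auto
    ultimately show ?thesis using le y by (simp add: cot_def abs_mult)
  qed
  consider "x = 0" | "x > 0" | "x < 0" by linarith
  then show ?thesis
    using *[of x] *[of "-x"] assms by cases (auto simp: cot_def)
qed

text \<open>For \<open>p > 0\<close>, a representative of \<open>m\<close> modulo \<open>p\<close>
  of least absolute value.\<close>

definition centered_residue :: "nat \<Rightarrow> int \<Rightarrow> int" where
  "centered_residue p m = m - int p * round (real_of_int m / real p)"

lemma cong_centered_residue: "[centered_residue p m = m] (mod int p)"
  by (simp add: centered_residue_def cong_iff_dvd_diff)

lemma abs_centered_residue_le: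
  assumes "p > 0"
  shows "2 * \<bar>real_of_int (centered_residue p m)\<bar> \<le> real p"
proof -
  have "real p * \<bar>of_int (round (real_of_int m / real p)) - real_of_int m / real p\<bar> \<le> real p * (1 / 2)"
    by (intro mult_left_mono of_int_round_abs_le) auto
  also have "real p * \<bar>of_int (round (real_of_int m / real p)) - real_of_int m / real p\<bar>
      = \<bar>real_of_int (centered_residue p m)\<bar>"
    using assms by (simp add: centered_residue_def abs_mult_pos' right_diff_distrib abs_minus_commute)
  finally show ?thesis by simp
qed

text \<open>By the period \<pi> of the cotangent, \<open>m\<close> may be replaced by its centred
  residue, which brings the argument into the range of \<open>abs_mult_cot_le_1\<close>.\<close>

lemma abs_cot_le_centered_residue:
  assumes "p > 0" "\<not> int p dvd m"
  shows "\<bar>cot (pi * real_of_int m / real p)\<bar> \<le> real p / (pi * \<bar>real_of_int (centered_residue p m)\<bar>)"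
proof -
  define a where "a = centered_residue p m"
  define q where "q = round (real_of_int m / real p)"
  have a0: "a \<noteq> 0" using cong_centered_residue[of p m] assms(2)
    by (metis a_def cong_0_iff cong_sym)
  have m: "real_of_int m = real_of_int a + real p * real_of_int q"
    by (simp add: a_def q_def centered_residue_def)
  have "pi * real_of_int m / real p = pi * real_of_int a / real p + of_int q * pi"
    using assms by (simp add: m field_simps)
  then have cot: "cot (pi * real_of_int m / real p) = cot (pi * real_of_int a / real p)"
    by (simp add: cot_altdef)
  have "\<bar>pi * real_of_int a / real p\<bar> \<le> pi / 2"
    using abs_centered_residue_le[OF assms(1), of m] assms(1)
    by (simp add: a_def abs_mult field_simps)
  from abs_mult_cot_le_1[OF this] show ?thesis
    using a0 assms(1) by (simp add: cot a_def[symmetric] abs_mult field_simps)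
qed

section \<open>A harmonic sum over separated points\<close>

lemma harm_le_ln_plus_1:
  assumes "n > 0"
  shows "harm n \<le> ln (real n) + 1"
proof -
  obtain m where m: "n = Suc m" using assms by (cases n) auto
  have "harm (Suc m) - ln (real (Suc m)) \<le> harm (Suc 0) - ln (real (Suc 0))"
    using decseq_harm_diff_ln unfolding decseq_def by blast
  then show ?thesis by (simp add: m harm_expand)
qed

text \<open>
  Cut the plane into squares of side \<open>L\<close> aligned with the axes. Separation puts at most one point
  into each square, and the four squares at the origin are empty.
\<close>

lemma sum_inverse_mult_separated_le:
  fixes a b :: "'a \<Rightarrow> int" and L :: real and K :: nat
  assumes fin: "finite S" and L: "L > 0"
    and ab: "\<And>n. n \<in> S \<Longrightarrow> a n \<noteq> 0 \<and> b n \<noteq> 0"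
    and le: "\<And>n. n \<in> S \<Longrightarrow> \<bar>a n\<bar> \<le> K * L \<and> \<bar>b n\<bar> \<le> K * L"
    and far: "\<And>n. n \<in> S \<Longrightarrow> 2 * L \<le> \<bar>a n\<bar> + \<bar>b n\<bar>"
    and sep: "\<And>m n. m \<in> S \<Longrightarrow> n \<in> S \<Longrightarrow> m \<noteq> n \<Longrightarrow> 2 * L \<le> \<bar>a m - a n\<bar> + \<bar>b m - b n\<bar>"
  shows "(\<Sum>n\<in>S. 1 / (\<bar>real_of_int (a n)\<bar> * \<bar>real_of_int (b n)\<bar>)) \<le> 4 * ((1 + harm K / L)\<^sup>2 - 1)"
proof -
  \<comment> \<open>\<open>f x\<close> is the index of the strip of width \<open>L\<close>
    containing \<open>|x|\<close>, and \<open>w\<close> bounds 1/|x| there; its value 1 at index 0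
    uses that \<open>x\<close> is a nonzero integer. \<open>g\<close> records the square of a point
    by signs and indices.\<close>
  define f where "f x = nat \<lfloor>\<bar>real_of_int x\<bar> / L\<rfloor>" for x
  define w where "w i = (if i = 0 then 1 else 1 / (real i * L))" for i :: nat
  define g where "g n = ((a n > 0, b n > 0), (f (a n), f (b n)))" for n
  define T where "T = (UNIV :: (bool \<times> bool) set) \<times> ({0..K} \<times> {0..K} - {(0, 0)})"
  have f_le: "real (f x) * L \<le> \<bar>real_of_int x\<bar>" 
    and f_gt: "\<bar>real_of_int x\<bar> < (real (f x) + 1) * L" for x
  proof -
    have f: "real (f x) = of_int \<lfloor>\<bar>real_of_int x\<bar> / L\<rfloor>"
      using L by (simp add: f_def)
    have "real (f x) \<le> \<bar>real_of_int x\<bar> / L" "\<bar>real_of_int x\<bar> / L < real (f x) + 1"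
      unfolding f by linarith+
    then show "real (f x) * L \<le> \<bar>real_of_int x\<bar>" "\<bar>real_of_int x\<bar> < (real (f x) + 1) * L"
      using L by (simp_all add: field_simps)
  qed
  have w0: "w i \<ge> 0" for i using L by (simp add: w_def)
  have w: "1 / \<bar>real_of_int x\<bar> \<le> w (f x)" if "x \<noteq> 0" for x
  proof (cases "f x = 0")
    case False
    then have "0 < real (f x) * L" using L by simp
    then show ?thesis using f_le[of x] False that by (simp add: w_def frac_le)
  qed (use that in \<open>simp add: w_def field_simps\<close>)
  \<comment> \<open>Two points in one square differ by less than \<open>L\<close> in each
    coordinate, against \<open>sep\<close>; so \<open>g\<close> is injective.\<close>
  have close: "\<bar>real_of_int x - real_of_int y\<bar> < L"
    if "x \<noteq> 0" "y \<noteq> 0" "x > 0 \<longleftrightarrow> y > 0" "f x = f y" for x y :: int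
  proof -
    have "\<bar>real_of_int x - real_of_int y\<bar> = \<bar>\<bar>real_of_int x\<bar> - \<bar>real_of_int y\<bar>\<bar>"
      using that by (cases "x > 0") auto
    also have "\<dots> < L"
      using f_le[of x] f_gt[of x] f_le[of y] f_gt[of y] that(4) by (simp add: algebra_simps)
    finally show ?thesis .
  qed
  have inj: "inj_on g S"
  proof (rule inj_onI, rule ccontr)
    fix m n assume mn: "m \<in> S" "n \<in> S" "g m = g n" "m \<noteq> n"
    have "\<bar>real_of_int (a m) - real_of_int (a n)\<bar> < L" "\<bar>real_of_int (b m) - real_of_int (b n)\<bar> < L"
      using mn ab by (auto simp: g_def intro!: close)
    then show False using sep[of m n] mn by simp
  qed
  have f_K: "f x \<le> K" if "\<bar>real_of_int x\<bar> \<le> K * L" for x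
  proof -
    have "real (f x) * L \<le> real K * L" using f_le[of x] that by linarith
    then show ?thesis using L by simp
  qed
  have gT: "g ` S \<subseteq> T"
  proof (rule image_subsetI)
    fix n assume n: "n \<in> S"
    have "\<not> (f (a n) = 0 \<and> f (b n) = 0)"
    proof
      assume "f (a n) = 0 \<and> f (b n) = 0"
      then show False using far[OF n] f_gt[of "a n"] f_gt[of "b n"] by simp
    qed
    then show "g n \<in> T" using le[OF n] f_K by (auto simp: g_def T_def)
  qed
  have sumw: "(\<Sum>i=0..K. w i) = 1 + harm K / L"
    by (simp add: sum.atLeast_Suc_atMost w_def harm_def sum_divide_distrib divide_simps)
  have "(\<Sum>n\<in>S. 1 / (\<bar>real_of_int (a n)\<bar> * \<bar>real_of_int (b n)\<bar>)) \<le> (\<Sum>n\<in>S. w (f (a n)) * w (f (b n)))"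
  proof (rule sum_mono)
    fix n assume n: "n \<in> S"
    have "1 / \<bar>real_of_int (a n)\<bar> * (1 / \<bar>real_of_int (b n)\<bar>) \<le> w (f (a n)) * w (f (b n))"
      using ab[OF n] w0 by (intro mult_mono w) auto
    then show "1 / (\<bar>real_of_int (a n)\<bar> * \<bar>real_of_int (b n)\<bar>) \<le> w (f (a n)) * w (f (b n))" by simp
  qed
  also have "\<dots> = (\<Sum>(s, i, j)\<in>g ` S. w i * w j)"
    by (subst sum.reindex[OF inj]) (simp add: g_def)
  also have "\<dots> \<le> (\<Sum>(s, i, j)\<in>T. w i * w j)"
    using gT w0 by (intro sum_mono2) (auto simp: T_def)
  \<comment> \<open>The factor 4 counts the sign patterns.\<close>
  also have "\<dots> = 4 * (\<Sum>(i, j)\<in>{0..K} \<times> {0..K} - {(0, 0)}. w i * w j)"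
    unfolding T_def by (subst sum.cartesian_product[symmetric]) (simp add: card_UNIV_bool)
  \<comment> \<open>The omitted pair \<open>(0, 0)\<close> has weight 1. This -1 cancels the
    constant term, so for fixed \<open>K\<close> the bound decays as \<open>L\<close> grows.\<close>
  also have "(\<Sum>(i, j)\<in>{0..K} \<times> {0..K} - {(0, 0)}. w i * w j) = (\<Sum>i=0..K. w i) * (\<Sum>j=0..K. w j) - 1"
    by (subst sum_diff1) (auto simp: w_def sum_product sum.cartesian_product)
  finally show ?thesis by (simp add: sumw power2_eq_square)
qed

subsection \<open>The bound\<close>

lemma abs_dedekind_sum_le_centered:
  assumes p: "prime p" and h: "\<not> int p dvd h"
  shows "\<bar>dedekind_sum h p\<bar> \<le> real p / (4 * pi\<^sup>2) *
    (\<Sum>n = 1..<p. 1 / (\<bar>real_of_int (centered_residue p (int n))\<bar> *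
                      \<bar>real_of_int (centered_residue p (int n * h))\<bar>))"
    (is "_ \<le> _ * sum ?f _")
proof -
  have p0: "p > 0" using p by (rule prime_gt_0_nat)
  have "\<bar>\<Sum>n = 1..<p. cot (pi * real n / real p) * cot (pi * real n * real_of_int h / real p)\<bar>
      \<le> (\<Sum>n = 1..<p. (real p)\<^sup>2 / pi\<^sup>2 * ?f n)"
  proof (rule order_trans[OF sum_abs sum_mono])
    fix n assume n: "n \<in> {1..<p}"
    have n1: "\<not> int p dvd int n" using n by (auto dest: dvd_imp_le)
    \<comment> \<open>Primality keeps the second cotangent away from its poles.\<close>
    have n2: "\<not> int p dvd int n * h" using n1 h p by (simp add: prime_dvd_mult_iff)
    have "\<bar>cot (pi * real n / real p) * cot (pi * real n * real_of_int h / real p)\<bar>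
        = \<bar>cot (pi * real_of_int (int n) / real p)\<bar> * \<bar>cot (pi * real_of_int (int n * h) / real p)\<bar>"
      by (simp add: abs_mult mult.assoc)
    also have "\<dots> \<le> real p / (pi * \<bar>real_of_int (centered_residue p (int n))\<bar>) *
        (real p / (pi * \<bar>real_of_int (centered_residue p (int n * h))\<bar>))"
      by (intro mult_mono abs_cot_le_centered_residue n1 n2 p0) auto
    also have "\<dots> = (real p)\<^sup>2 / pi\<^sup>2 * ?f n" by (simp add: power2_eq_square)
    finally show "\<bar>cot (pi * real n / real p) * cot (pi * real n * real_of_int h / real p)\<bar>
      \<le> (real p)\<^sup>2 / pi\<^sup>2 * ?f n" .
  qed
  then have "\<bar>dedekind_sum h p\<bar> \<le> 1 / (4 * real p) * ((real p)\<^sup>2 / pi\<^sup>2 * sum ?f {1..<p})"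
    unfolding dedekind_sum_def abs_mult sum_distrib_left[symmetric]
    by (intro mult_mono) auto
  also have "\<dots> = real p / (4 * pi\<^sup>2) * sum ?f {1..<p}"
    using p0 by (simp add: power2_eq_square)
  finally show ?thesis .
qed

text \<open>The points formed by the two centred residues lie in the lattice b \<equiv> h a. One
  lower bound for lattice points serves both the distance from the origin and, through differences,
  the mutual separation.\<close>

lemma sum_centered_residues_le:
  fixes h :: int and p k :: nat
  defines "L \<equiv> real p powr (1 / real (totient k)) / 2"
  assumes p: "prime p" and k: "k \<ge> 3" and ord: "\<And>m. [h ^ m = 1] (mod int p) \<longleftrightarrow> k dvd m"
    and h: "\<not> int p dvd h"
  shows "(\<Sum>n = 1..<p. 1 / (\<bar>real_of_int (centered_residue p (int n))\<bar> *
                      \<bar>real_of_int (centered_residue p (int n * h))\<bar>))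
    \<le> 4 * ((1 + harm p / L)\<^sup>2 - 1)"
proof (rule sum_inverse_mult_separated_le)
  have p1: "real p > 1" using prime_gt_1_nat[OF p] by simp
  have t: "totient k > 0" using k by simp
  show L0: "L > 0" using p1 by (simp add: L_def)
  \<comment> \<open>Hence p/2 \<le> p L, so \<open>p\<close> is an admissible choice of
    \<open>K\<close>.\<close>
  have L1: "L \<ge> 1 / 2" using p1 by (simp add: L_def ge_one_powr_ge_zero)
  have far: "2 * L \<le> \<bar>a\<bar> + \<bar>b\<bar>" if "\<not> int p dvd a" "[b = h * a] (mod int p)" for a b :: int
  proof -
    have "real_of_int (int p) \<le> of_int ((\<bar>a\<bar> + \<bar>b\<bar>) ^ totient k)"
      using lattice_point_lower_bound[OF p k ord that] by (simp only: of_int_le_iff)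
    then have le: "real p \<le> real_of_int (\<bar>a\<bar> + \<bar>b\<bar>) ^ totient k" by simp
    \<comment> \<open>Take the \<phi>(k)-th root of the lattice point bound.\<close>
    have "2 * L \<le> (real_of_int (\<bar>a\<bar> + \<bar>b\<bar>) ^ totient k) powr (1 / real (totient k))"
      using le by (simp add: L_def powr_mono2)
    also have "\<dots> = real_of_int (\<bar>a\<bar> + \<bar>b\<bar>)"
    proof -
      have "a \<noteq> 0" using that by auto
      then have "real_of_int (\<bar>a\<bar> + \<bar>b\<bar>) > 0" by linarith
      then show ?thesis using t by (simp add: powr_powr flip: powr_realpow)
    qed
    finally show ?thesis by simp
  qed
  let ?a = "\<lambda>n. centered_residue p (int n)" and ?b = "\<lambda>n. centered_residue p (int n * h)"
  have cong: "[?b n = h * ?a n] (mod int p)" for n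
    using cong_centered_residue[of p "int n * h"] 
      cong_scalar_left[OF cong_centered_residue[of p "int n"], of h]
    by (metis cong_sym cong_trans mult.commute)
  have dvd: "int p dvd centered_residue p m \<longleftrightarrow> int p dvd m" for m
    using cong_centered_residue by (rule cong_dvd_iff)
  have bound: "\<bar>real_of_int (centered_residue p m)\<bar> \<le> p * L" for m
  proof -
    have "\<bar>real_of_int (centered_residue p m)\<bar> \<le> p * (1 / 2)"
      using abs_centered_residue_le[of p m] p1 by simp
    also have "\<dots> \<le> p * L" using L1 p1 by (intro mult_left_mono) auto
    finally show ?thesis .
  qed
  {
    fix n assume n: "n \<in> {1..<p}"
    have n1: "\<not> int p dvd int n" using n by (auto dest: dvd_imp_le)
    then have n2: "\<not> int p dvd int n * h" using h p by (simp add: prime_dvd_mult_iff)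
    show "?a n \<noteq> 0 \<and> ?b n \<noteq> 0" using n1 n2 dvd by (metis dvd_0_right)
    show "\<bar>?a n\<bar> \<le> p * L \<and> \<bar>?b n\<bar> \<le> p * L" using bound by simp
    show "2 * L \<le> \<bar>?a n\<bar> + \<bar>?b n\<bar>" using n1 dvd cong by (intro far) auto
  next
    fix m n assume mn: "m \<in> {1..<p}" "n \<in> {1..<p}" "m \<noteq> n"
    \<comment> \<open>Needed to apply \<open>far\<close> to the difference of two points: distinct
      indices below \<open>p\<close> are incongruent.\<close>
    have "\<not> int p dvd ?a m - ?a n"
    proof
      assume "int p dvd ?a m - ?a n"
      then have "[?a m = ?a n] (mod int p)" by (simp add: cong_iff_dvd_diff)
      then have "[int m = int n] (mod int p)"
        by (meson cong_centered_residue cong_sym cong_trans)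
      then show False using mn by (simp add: cong_int_iff cong_less_modulus_unique_nat)
    qed
    moreover have "[?b m - ?b n = h * (?a m - ?a n)] (mod int p)"
      unfolding right_diff_distrib by (intro cong_diff cong)
    ultimately have "2 * L \<le> \<bar>?a m - ?a n\<bar> + \<bar>?b m - ?b n\<bar>" by (rule far)
    then show "2 * L \<le> \<bar>?a m - ?a n\<bar> + \<bar>?b m - ?b n\<bar>" .
  }
qed simp

theorem theorem3p1:
  shows "\<exists>C::real. C > 0 \<and>
    (\<forall>(p::nat) (h::int) (k::nat).
       prime p \<longrightarrow>
       h mod int p \<in> carrier (residue_units p) \<longrightarrow>
       group.ord (residue_units p) (h mod int p) = k \<longrightarrow>
       odd k \<longrightarrow> k \<ge> 3 \<longrightarrow>
       \<bar>dedekind_sum h p\<bar> \<le> C * (ln (real p))\<^sup>2 * real p powr (1 - 1 / real (totient k)))"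
\<comment> \<open>The witness is 8 = (8/9) * 3^2: the 8/9 comes from (4 + 4)/9 with 9 \<le> \<pi>^2,
  the 3^2 from \<open>H \<le> 3 * ln p\<close>.\<close>
proof (intro exI[of _ 8] conjI allI impI)
  fix p k :: nat and h :: int
  assume p: "prime p" and h: "h mod int p \<in> carrier (residue_units p)"
    and k: "group.ord (residue_units p) (h mod int p) = k" "k \<ge> 3"
  define M where "M = real p powr (1 / real (totient k))"
  define H where "H = (harm p :: real)"
  have p1: "p > 1" using p by (rule prime_gt_1_nat)
  have M: "M \<ge> 1" using p1 by (simp add: M_def ge_one_powr_ge_zero)
  have ord: "[h ^ m = 1] (mod int p) \<longleftrightarrow> k dvd m" for m
    using residue_units_ord_dvd_iff[OF p1 h] k by simp
  have nd: "\<not> int p dvd h"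
  proof
    assume "int p dvd h"
    moreover have "h dvd h ^ k" using k(2) by (intro dvd_power) simp
    ultimately have "int p dvd h ^ k" by (rule dvd_trans)
    moreover have "int p dvd h ^ k - 1" using ord[of k] by (simp add: cong_iff_dvd_diff)
    ultimately have "int p dvd h ^ k - (h ^ k - 1)" by (rule dvd_diff)
    then show False using p1 by simp
  qed
  have H1: "H \<ge> 1" using harm_mono[of 1 p, where ?'a = real] p1 by (simp add: H_def harm_expand)
  \<comment> \<open>As ln 2 \<ge> 2/3, the additive 1 in the harmonic bound is absorbed into 2 ln
    p.\<close>
  have "ln 2 \<le> ln (real p)" using p1 by simp
  then have "1 \<le> 2 * ln (real p)" using ln2_ge_two_thirds by simp
  then have H3: "H \<le> 3 * ln (real p)"
    using harm_le_ln_plus_1[of p] p1 by (simp add: H_def)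
  have pi: "9 \<le> pi\<^sup>2" using pi_gt3 power_mono[of 3 pi 2] by simp
  have "\<bar>dedekind_sum h p\<bar> \<le> real p / (4 * pi\<^sup>2) * (4 * ((1 + H / (M / 2))\<^sup>2 - 1))"
    unfolding H_def M_def
    by (intro order_trans[OF abs_dedekind_sum_le_centered[OF p nd]] mult_left_mono
          sum_centered_residues_le p k ord nd) auto
  also have "\<dots> = real p / pi\<^sup>2 * (4 * (H * 1) / M + 4 * H\<^sup>2 / M * (1 / M))"
    using M by (simp add: field_simps power2_eq_square)
  \<comment> \<open>\<open>H \<ge> 1\<close> raises the linear term to \<open>H * H\<close>, and
    \<open>M \<ge> 1\<close> drops the second factor 1/M, so both terms have size
    \<open>H\<^sup>2 / M\<close>.\<close>
  also have "\<dots> \<le> real p / 9 * (4 * (H * H) / M + 4 * H\<^sup>2 / M * 1)"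
    using M H1 pi by (intro mult_mono add_mono divide_right_mono mult_left_mono frac_le) auto
  also have "\<dots> = 8 / 9 * H\<^sup>2 * (real p / M)" by (simp add: power2_eq_square)
  also have "\<dots> \<le> 8 / 9 * (3 * ln (real p))\<^sup>2 * (real p / M)"
    using H1 H3 M by (intro mult_right_mono mult_left_mono power_mono) auto
  also have "real p / M = real p powr (1 - 1 / real (totient k))"
    using p1 by (simp add: M_def powr_diff)
  finally show "\<bar>dedekind_sum h p\<bar> \<le> 8 * (ln (real p))\<^sup>2 * real p powr (1 - 1 / real (totient k))"
    by (simp add: power_mult_distrib)
qed simp

end
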